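(* Let $d,l,f\ge1$ be integers and let $\mathrm{U}$ be any instance of any U-Net with $d$-dimensional input images, $l$ pooling layers and pooling factor $f$ (with fixed or learnt upsampling). Then $\mathrm{U}$ distinguishes at most $f^{dl}$ same-looking instances: for every image $I$, every set $S\subset\mathbf{Z}^d$ of center points of object instances in $I$ that are pairwise same-looking, and every representative pixel offset $\mathbf{r}\in\mathbf{Z}^d$, the set of embeddings $\{\mathrm{U}(I)(\mathbf{c}+\mathbf{r}) : \mathbf{c}\in S\}$ has at most $f^{dl}$ elements.
   Context: Images and shifts. A $d$-dimensional image with $C\ge1$ channels is a function $I:\mathbf{Z}^d\to\mathbf{R}^C$. For $\Delta\mathbf{x}\in\mathbf{Z}^d$, the shift is $T_{\Delta\mathbf{x}}(I)(\mathbf{x}) := I(\mathbf{x}-\Delta\mathbf{x})$. Layers. A convolution layer (stride 1, with bias) maps $g$ with $C$ channels to $C'$ channels by $\mathbf{x}\mapsto b+\sum_{\mathbf{m}\in K}A_{\mathbf{m}}\,g(\mathbf{x}+\mathbf{m})$, with $K\subset\mathbf{Z}^d$ a fixed non-empty finite kernel support and trainable $b\in\mathbf{R}^{C'}$, $A_{\mathbf{m}}\in\mathbf{R}^{C'\times C}$ (valid convolutions: no padding). ReLU is applied pointwise: $t\mapsto\max(0,t)$. Max-pooling with factor $f$ (kernel size and stride $f$) is, per channel, $g\mapsto\big(\mathbf{x}\mapsto\max\{g(f\mathbf{x}+\mathbf{i}) : \mathbf{i}\in\{0,\dots,f-1\}^d\}\big)$. Upsampling with factor $f$ maps $g$ to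 the image whose value at $f\mathbf{m}+\mathbf{i}$ ($\mathbf{m}\in\mathbf{Z}^d$, $\mathbf{i}\in\{0,\dots,f-1\}^d$) is $g(\mathbf{m})$ (fixed, nearest-neighbor upsampling), or $P_{\mathbf{i}}\,g(\mathbf{m})$ with trainable matrices $P_{\mathbf{i}}$ (learnt upsampling, i.e. transposed convolution with kernel size = stride = $f$). U-Net. A U-Net with $l$ pooling layers and pooling factor $f$ is an architecture (fixed choice of kernel supports, numbers of layers, channel numbers $\ge 1$, type of upsampling, and alignment shifts) as follows. Blocks $E_1,\dots,E_l$ and $D_l,\dots,D_1,D_0$ each consist of one or more (convolution + ReLU) layers. Encoder: $e_1=E_1(I)$, $e_{i+1}=E_{i+1}(\text{maxpool}_f(e_i))$ for $1\le i<l$. Decoder: $q_l=\text{upsample}_f(D_l(\text{maxpool}_f(e_l)))$; for $i=l-1,\dots,1$, $q_i=\text{upsample}_f(D_i(T_{\Delta x_{i+1}}(e_{i+1}),\,q_{i+1}))$, where $(\cdot,\cdot)$ is channel concatenation (skip connection) and $\Delta x_{i+1}\in\mathbf{Z}^d$ is a fixed alignment shift; output $\mathrm{U}(I)=D_0(T_{\Delta x_1}(e_1),q_1)$, with $C^{out}$ channels. A U-Net instance is a U-Net with specific weights (all convolution weights and biases and, for learnt upsampling, all upsampling kernels). The output $\mathrm{U}(I)(\mathbf{x})\in\mathbf{R}^{C^{out}}$ is the embedding of pixel $\mathbf{x}$. Same-looking instances. Object instances in an image $I$ with center points $\mathbf{c},\mathbf{c}'\in\mathbf{Z}^d$ are same-looking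 iff $I$ is invariant to shifting by the offset between the center points, i.e. $T_{\mathbf{c}'-\mathbf{c}}(I)=I$. Distinguishing. Fix a representative pixel of an instance, at offset $\mathbf{r}\in\mathbf{Z}^d$ from its center (e.g. the central pixel, $\mathbf{r}=0$). Same-looking instances with centers $\mathbf{c},\mathbf{c}'$ are distinguished iff the embeddings of their representative pixels differ: $\mathrm{U}(I)(\mathbf{c}+\mathbf{r})\ne\mathrm{U}(I)(\mathbf{c}'+\mathbf{r})$. *)

theory Defs
  imports
    "HOL-Analysis.Finite_Cartesian_Product"
    "Jordan_Normal_Form.Matrix"
begin

text \<open>
  Pixels are points of \<open>int ^ 'd\<close>, so the dimension is \<open>CARD('d)\<close>. Channel numbers vary inside
  a network, so pixel values are the variable-length vectors \<open>real Matrix.vec\<close>. The notation \<open>$\<close> is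
  kept for pixel coordinates only.
\<close>

no_notation vec_index (infixl \<open>$\<close> 100)

type_synonym 'd image = "int ^ 'd \<Rightarrow> real Matrix.vec"

definition images :: "nat \<Rightarrow> 'd::finite image set" where
  "images C = {g. \<forall>x. g x \<in> carrier_vec C}"

definition shift :: "int ^ 'd \<Rightarrow> 'd::finite image \<Rightarrow> 'd image" where
  "shift \<Delta> g = (\<lambda>x. g (x - \<Delta>))"

definition conv :: "(int ^ 'd) set \<Rightarrow> (int ^ 'd \<Rightarrow> real mat) \<Rightarrow> real Matrix.vec
    \<Rightarrow> 'd::finite image \<Rightarrow> 'd image" where
  "conv K A b g = (\<lambda>x. b + finsum_vec TYPE(real) (dim_vec b) (\<lambda>m. A m *\<^sub>v g (x + m)) K)"

definition relu :: "'d::finite image \<Rightarrow> 'd image" where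
  "relu g = (\<lambda>x. map_vec (max 0) (g x))"

definition scale_pixel :: "nat \<Rightarrow> int ^ 'd \<Rightarrow> int ^ 'd::finite" where
  "scale_pixel f x = (\<chi> k. int f * x $ k)"

definition window :: "nat \<Rightarrow> (int ^ 'd::finite) set" where
  "window f = {i. \<forall>k. i $ k \<in> {0..<int f}}"

definition maxpool :: "nat \<Rightarrow> 'd::finite image \<Rightarrow> 'd image" where
  "maxpool f g = (\<lambda>x. Matrix.vec (dim_vec (g (scale_pixel f x)))
     (\<lambda>c. Max ((\<lambda>i. vec_index (g (scale_pixel f x + i)) c) ` window f)))"

definition concat_channels :: "'d::finite image \<Rightarrow> 'd image \<Rightarrow> 'd image" where
  "concat_channels g h = (\<lambda>x. g x @\<^sub>v h x)"

text \<open>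
  For \<open>f \<ge> 1\<close> each pixel is \<open>f m + i\<close> for exactly one \<open>m\<close> and one \<open>i\<close> in the window; these are given
  by coordinatewise \<open>div\<close> and \<open>mod\<close> (which round towards minus infinity, also for negative
  coordinates).
\<close>

definition coarse_pixel :: "nat \<Rightarrow> int ^ 'd \<Rightarrow> int ^ 'd::finite" where
  "coarse_pixel f x = (\<chi> k. x $ k div int f)"

definition window_offset :: "nat \<Rightarrow> int ^ 'd \<Rightarrow> int ^ 'd::finite" where
  "window_offset f x = (\<chi> k. x $ k mod int f)"

definition upsample_nearest :: "nat \<Rightarrow> 'd::finite image \<Rightarrow> 'd image" where
  "upsample_nearest f g = (\<lambda>x. g (coarse_pixel f x))"

definition upsample_learnt :: "nat \<Rightarrow> (int ^ 'd \<Rightarrow> real mat) \<Rightarrow> 'd::finite image \<Rightarrow> 'd image" where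
  "upsample_learnt f P g = (\<lambda>x. P (window_offset f x) *\<^sub>v g (coarse_pixel f x))"

lemma coarse_pixel_scale_plus:
  assumes "i \<in> window f"
  shows "coarse_pixel f (scale_pixel f m + i) = m"
proof -
  have "(int f * m $ k + i $ k) div int f = m $ k" for k
    using assms by (cases "f = 0") (auto simp: window_def)
  then show ?thesis by (simp add: coarse_pixel_def scale_pixel_def Finite_Cartesian_Product.vec_eq_iff)
qed

lemma window_offset_scale_plus:
  assumes "i \<in> window f"
  shows "window_offset f (scale_pixel f m + i) = i"
  using assms by (auto simp: window_offset_def scale_pixel_def window_def Finite_Cartesian_Product.vec_eq_iff)

lemma upsample_nearest_at:
  assumes "i \<in> window f"
  shows "upsample_nearest f g (scale_pixel f m + i) = g m"
  using assms by (simp add: upsample_nearest_def coarse_pixel_scale_plus)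

lemma upsample_learnt_at:
  assumes "i \<in> window f"
  shows "upsample_learnt f P g (scale_pixel f m + i) = P i *\<^sub>v g m"
  using assms
  by (simp add: upsample_learnt_def coarse_pixel_scale_plus window_offset_scale_plus)

lemma scale_pixel_coarse_pixel_plus_window_offset:
  "scale_pixel f (coarse_pixel f x) + window_offset f x = x"
  by (simp add: scale_pixel_def coarse_pixel_def window_offset_def
    Finite_Cartesian_Product.vec_eq_iff)

lemma window_offset_in_window:
  assumes "f \<ge> 1"
  shows "window_offset f x \<in> window f"
  using assms by (simp add: window_offset_def window_def)

record ('d::finite) conv_arch =
  kernel_support :: "(int ^ 'd) set"
  out_channels :: nat

record ('d::finite) conv_weights =
  kernel_mat :: "int ^ 'd \<Rightarrow> real mat"
  bias :: "real Matrix.vec"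

text \<open>
  \<open>Learnt c\<close>: the learnt upsampling that produces \<open>q\<^sub>i\<close> has \<open>c i\<close> output channels. Nearest-neighbour
  upsampling keeps the number of channels.
\<close>

datatype upsampling = Nearest | Learnt "nat \<Rightarrow> nat"

text \<open>
  With \<open>l\<close> pooling layers, \<open>enc_arch\<close>, \<open>alignment\<close> and the upsampling data are used at the indices
  \<open>1..l\<close> and \<open>dec_arch\<close> at the indices \<open>0..l\<close>; other values are irrelevant.
\<close>

record ('d::finite) unet_arch =
  pool_layers :: nat
  pool_factor :: nat
  in_channels :: nat
  enc_arch :: "nat \<Rightarrow> 'd conv_arch list"
  dec_arch :: "nat \<Rightarrow> 'd conv_arch list"
  upsampling_type :: upsampling
  alignment :: "nat \<Rightarrow> int ^ 'd"

record ('d::finite) unet_weights =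
  enc_weights :: "nat \<Rightarrow> 'd conv_weights list"
  dec_weights :: "nat \<Rightarrow> 'd conv_weights list"
  up_kernel :: "nat \<Rightarrow> int ^ 'd \<Rightarrow> real mat"

definition block_arch_wf :: "'d::finite conv_arch list \<Rightarrow> bool" where
  "block_arch_wf ss \<longleftrightarrow> ss \<noteq> [] \<and>
     (\<forall>s\<in>set ss. finite (kernel_support s) \<and> kernel_support s \<noteq> {} \<and> out_channels s \<ge> 1)"

definition unet_arch_wf :: "'d::finite unet_arch \<Rightarrow> bool" where
  "unet_arch_wf N \<longleftrightarrow>
     pool_layers N \<ge> 1 \<and> pool_factor N \<ge> 1 \<and> in_channels N \<ge> 1 \<and>
     (\<forall>i\<in>{1..pool_layers N}. block_arch_wf (enc_arch N i)) \<and>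
     (\<forall>i\<in>{0..pool_layers N}. block_arch_wf (dec_arch N i)) \<and>
     (case upsampling_type N of
        Nearest \<Rightarrow> True
      | Learnt c \<Rightarrow> \<forall>i\<in>{1..pool_layers N}. c i \<ge> 1)"

definition enc_channels :: "'d::finite unet_arch \<Rightarrow> nat \<Rightarrow> nat" where
  "enc_channels N i = out_channels (last (enc_arch N i))"

definition dec_channels :: "'d::finite unet_arch \<Rightarrow> nat \<Rightarrow> nat" where
  "dec_channels N i = out_channels (last (dec_arch N i))"

definition up_channels :: "'d::finite unet_arch \<Rightarrow> nat \<Rightarrow> nat" where
  "up_channels N i =
     (case upsampling_type N of Nearest \<Rightarrow> dec_channels N i | Learnt c \<Rightarrow> c i)"

definition enc_in_channels :: "'d::finite unet_arch \<Rightarrow> nat \<Rightarrow> nat" where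
  "enc_in_channels N i = (if i = 1 then in_channels N else enc_channels N (i - 1))"

definition dec_in_channels :: "'d::finite unet_arch \<Rightarrow> nat \<Rightarrow> nat" where
  "dec_in_channels N i =
     (if i = pool_layers N then enc_channels N i
      else enc_channels N (i + 1) + up_channels N (i + 1))"

text \<open>\<open>block_weights_fit C ss ws\<close>: the weights \<open>ws\<close> fit a block \<open>ss\<close> with \<open>C\<close> input channels.\<close>

fun block_weights_fit :: "nat \<Rightarrow> 'd::finite conv_arch list \<Rightarrow> 'd conv_weights list \<Rightarrow> bool" where
  "block_weights_fit C [] [] \<longleftrightarrow> True"
| "block_weights_fit C (s # ss) (w # ws) \<longleftrightarrow>
     bias w \<in> carrier_vec (out_channels s) \<and>
     (\<forall>m\<in>kernel_support s. kernel_mat w m \<in> carrier_mat (out_channels s) C) \<and>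
     block_weights_fit (out_channels s) ss ws"
| "block_weights_fit C _ _ \<longleftrightarrow> False"

definition unet_instance :: "'d::finite unet_arch \<Rightarrow> 'd unet_weights \<Rightarrow> bool" where
  "unet_instance N W \<longleftrightarrow> unet_arch_wf N \<and>
     (\<forall>i\<in>{1..pool_layers N}.
        block_weights_fit (enc_in_channels N i) (enc_arch N i) (enc_weights W i)) \<and>
     (\<forall>i\<in>{0..pool_layers N}.
        block_weights_fit (dec_in_channels N i) (dec_arch N i) (dec_weights W i)) \<and>
     (case upsampling_type N of
        Nearest \<Rightarrow> True
      | Learnt c \<Rightarrow> \<forall>i\<in>{1..pool_layers N}. \<forall>j\<in>window (pool_factor N).
          up_kernel W i j \<in> carrier_mat (c i) (dec_channels N i))"

fun apply_block :: "'d::finite conv_arch list \<Rightarrow> 'd conv_weights list \<Rightarrow> 'd image \<Rightarrow> 'd image" where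
  "apply_block (s # ss) (w # ws) g =
     apply_block ss ws (relu (conv (kernel_support s) (kernel_mat w) (bias w) g))"
| "apply_block _ _ g = g"

definition upsample :: "'d::finite unet_arch \<Rightarrow> 'd unet_weights \<Rightarrow> nat \<Rightarrow> 'd image \<Rightarrow> 'd image" where
  "upsample N W i =
     (case upsampling_type N of
        Nearest \<Rightarrow> upsample_nearest (pool_factor N)
      | Learnt c \<Rightarrow> upsample_learnt (pool_factor N) (up_kernel W i))"

text \<open>\<open>enc_out N W I i\<close> is \<open>e\<^sub>i\<close> for \<open>i \<ge> 1\<close>; the value at \<open>0\<close> is the input image.\<close>

fun enc_out :: "'d::finite unet_arch \<Rightarrow> 'd unet_weights \<Rightarrow> 'd image \<Rightarrow> nat \<Rightarrow> 'd image" where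
  "enc_out N W I 0 = I"
| "enc_out N W I (Suc 0) = apply_block (enc_arch N 1) (enc_weights W 1) I"
| "enc_out N W I (Suc (Suc i)) =
     apply_block (enc_arch N (Suc (Suc i))) (enc_weights W (Suc (Suc i)))
       (maxpool (pool_factor N) (enc_out N W I (Suc i)))"

text \<open>
  \<open>dec_out N W I i\<close> is the output of the block \<open>D\<^sub>i\<close>, so \<open>q\<^sub>i = upsample N W i (dec_out N W I i)\<close>
  for \<open>1 \<le> i \<le> l\<close>. The recursion runs from \<open>i = l\<close> down to \<open>i = 0\<close>.
\<close>

function dec_out :: "'d::finite unet_arch \<Rightarrow> 'd unet_weights \<Rightarrow> 'd image \<Rightarrow> nat \<Rightarrow> 'd image" where
  "dec_out N W I i = apply_block (dec_arch N i) (dec_weights W i)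
     (if i < pool_layers N
      then concat_channels (shift (alignment N (i + 1)) (enc_out N W I (i + 1)))
             (upsample N W (i + 1) (dec_out N W I (i + 1)))
      else maxpool (pool_factor N) (enc_out N W I (pool_layers N)))"
  by pat_completeness auto
termination
  by (relation "measure (\<lambda>(N, W, I, i). pool_layers N - i)") auto

declare dec_out.simps [simp del]

definition unet :: "'d::finite unet_arch \<Rightarrow> 'd unet_weights \<Rightarrow> 'd image \<Rightarrow> 'd image" where
  "unet N W I = dec_out N W I 0"

lemma apply_block_in_images:
  assumes "block_weights_fit C ss ws" and "ss \<noteq> []" and "g \<in> images C"
  shows "apply_block ss ws g \<in> images (out_channels (last ss))"
  using assms
proof (induction C ss ws arbitrary: g rule: block_weights_fit.induct)
  case (2 C s ss w ws)
  let ?K = "kernel_support s" and ?h = "relu (conv (kernel_support s) (kernel_mat w) (bias w) g)"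
  have b: "bias w \<in> carrier_vec (out_channels s)" using "2.prems" by simp
  have "(\<lambda>m. kernel_mat w m *\<^sub>v g (x + m)) \<in> ?K \<rightarrow> carrier_vec (out_channels s)" for x
    using "2.prems" by (auto simp: images_def intro!: mult_mat_vec_carrier)
  from finsum_vec_closed[OF this] b have h: "?h \<in> images (out_channels s)"
    by (auto simp: images_def relu_def conv_def)
  show ?case
  proof (cases ss)
    case Nil
    then show ?thesis using "2.prems" h by (cases ws) simp_all
  next
    case Cons
    then show ?thesis using 2 h by simp
  qed
qed auto

lemma maxpool_in_images:
  assumes "g \<in> images C"
  shows "maxpool f g \<in> images C"
proof -
  have "dim_vec (g x) = C" for x using assms carrier_vecD by (auto simp: images_def)
  then show ?thesis by (simp add: images_def maxpool_def)
qed

lemma upsample_in_images: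
  fixes N :: "'a::finite unet_arch"
  assumes "unet_instance N W" and "i \<in> {1..pool_layers N}" and "g \<in> images (dec_channels N i)"
  shows "upsample N W i g \<in> images (up_channels N i)"
proof (cases "upsampling_type N")
  case Nearest
  then show ?thesis
    using assms by (simp add: upsample_def up_channels_def images_def upsample_nearest_def)
next
  case (Learnt c)
  have "window_offset (pool_factor N) x \<in> window (pool_factor N)" for x :: "int ^ 'a"
    using assms(1) by (simp add: unet_instance_def unet_arch_wf_def window_offset_in_window)
  then have "up_kernel W i (window_offset (pool_factor N) x) \<in> carrier_mat (c i) (dec_channels N i)" for x
    using assms(1,2) Learnt by (simp add: unet_instance_def)
  moreover have "g x \<in> carrier_vec (dec_channels N i)" for x
    using assms(3) by (simp add: images_def)
  ultimately have "up_kernel W i (window_offset (pool_factor N) x) *\<^sub>v g y \<in> carrier_vec (c i)" for x y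
    by (rule mult_mat_vec_carrier)
  then show ?thesis
    using Learnt by (simp add: upsample_def up_channels_def images_def upsample_learnt_def)
qed

lemma enc_out_in_images:
  assumes W: "unet_instance N W" and I: "I \<in> images (in_channels N)"
    and "i \<in> {1..pool_layers N}"
  shows "enc_out N W I i \<in> images (enc_channels N i)"
  using assms(3)
proof (induction i)
  case 0
  then show ?case by simp
next
  case (Suc i)
  have fit: "block_weights_fit (enc_in_channels N (Suc i)) (enc_arch N (Suc i)) (enc_weights W (Suc i))"
    and ne: "enc_arch N (Suc i) \<noteq> []"
    using W Suc.prems by (auto simp: unet_instance_def unet_arch_wf_def block_arch_wf_def)
  show ?case
  proof (cases i)
    case 0
    then show ?thesis
      using apply_block_in_images[OF fit ne, of I] I by (simp add: enc_in_channels_def enc_channels_def)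
  next
    case (Suc j)
    then have "maxpool (pool_factor N) (enc_out N W I i) \<in> images (enc_in_channels N (Suc i))"
      using Suc.IH Suc.prems by (simp add: enc_in_channels_def maxpool_in_images)
    from apply_block_in_images[OF fit ne this] Suc show ?thesis by (simp add: enc_channels_def)
  qed
qed

lemma dec_out_in_images:
  assumes W: "unet_instance N W" and I: "I \<in> images (in_channels N)"
    and "i \<le> pool_layers N"
  shows "dec_out N W I i \<in> images (dec_channels N i)"
  using assms(3)
proof (induction i rule: inc_induct)
  case base
  let ?l = "pool_layers N"
  have l: "?l \<in> {1..?l}" using W by (auto simp: unet_instance_def unet_arch_wf_def)
  have fit: "block_weights_fit (dec_in_channels N ?l) (dec_arch N ?l) (dec_weights W ?l)"
    and ne: "dec_arch N ?l \<noteq> []"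
    using W by (auto simp: unet_instance_def unet_arch_wf_def block_arch_wf_def)
  have "maxpool (pool_factor N) (enc_out N W I ?l) \<in> images (dec_in_channels N ?l)"
    using enc_out_in_images[OF W I l] by (simp add: dec_in_channels_def maxpool_in_images)
  from apply_block_in_images[OF fit ne this] show ?case
    by (simp add: dec_out.simps[of N W I ?l] dec_channels_def)
next
  case (step i)
  have i: "Suc i \<in> {1..pool_layers N}" using step by simp
  have fit: "block_weights_fit (dec_in_channels N i) (dec_arch N i) (dec_weights W i)"
    and ne: "dec_arch N i \<noteq> []"
    using W step by (auto simp: unet_instance_def unet_arch_wf_def block_arch_wf_def)
  have "concat_channels (shift (alignment N (Suc i)) (enc_out N W I (Suc i)))
      (upsample N W (Suc i) (dec_out N W I (Suc i))) \<in> images (dec_in_channels N i)"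
    using enc_out_in_images[OF W I i] upsample_in_images[OF W i step.IH] step
    by (auto simp: images_def concat_channels_def shift_def dec_in_channels_def)
  from apply_block_in_images[OF fit ne this] show ?case
    using step by (simp add: dec_out.simps[of N W I i] dec_channels_def)
qed

text \<open>All the operations inside an instance are applied at matching dimensions.\<close>

theorem unet_in_images:
  assumes "unet_instance N W" and "I \<in> images (in_channels N)"
  shows "unet N W I \<in> images (dec_channels N 0)"
  using dec_out_in_images[OF assms, of 0] by (simp add: unet_def)

definition same_looking :: "'d::finite image \<Rightarrow> int ^ 'd \<Rightarrow> int ^ 'd \<Rightarrow> bool" where
  "same_looking I c c' \<longleftrightarrow> shift (c' - c) I = I"

end

theory Submission
  imports Defs
begin

text \<open>
  A U-Net is equivariant under shifts by multiples of \<open>f\<^sup>l\<close>: pooling turns a shift by \<open>f u\<close> into a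
  shift by \<open>u\<close>, upsampling turns it back, and all other layers commute with every shift. If two
  same-looking instances have centers that are congruent modulo \<open>f\<^sup>l\<close> in each coordinate, then the
  image, and hence the output, is invariant under their offset, so their embeddings agree. There are
  only \<open>f\<^sup>d\<^sup>l\<close> residue classes.
\<close>

lemma scale_pixel_mult: "scale_pixel (a * b) u = scale_pixel a (scale_pixel b u)"
  by (simp add: scale_pixel_def Finite_Cartesian_Product.vec_eq_iff)

lemma scale_pixel_1 [simp]: "scale_pixel (Suc 0) u = u"
  by (simp add: scale_pixel_def Finite_Cartesian_Product.vec_eq_iff)

lemma scale_pixel_diff: "scale_pixel f (x - y) = scale_pixel f x - scale_pixel f y"
  by (simp add: scale_pixel_def Finite_Cartesian_Product.vec_eq_iff algebra_simps)

lemma coarse_pixel_diff_scale: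
  assumes "f \<ge> 1"
  shows "coarse_pixel f (x - scale_pixel f u) = coarse_pixel f x - u"
proof -
  have "(a - int f * b) div int f = a div int f - b" for a b
    using assms div_mult_self2[of "int f" a "- b"] by simp
  then show ?thesis
    by (simp add: coarse_pixel_def scale_pixel_def Finite_Cartesian_Product.vec_eq_iff)
qed

lemma window_offset_diff_scale: "window_offset f (x - scale_pixel f u) = window_offset f x"
proof -
  have "(a - int f * b) mod int f = a mod int f" for a b
    using mod_mult_self2[of a "int f" "- b"] by simp
  then show ?thesis
    by (simp add: window_offset_def scale_pixel_def Finite_Cartesian_Product.vec_eq_iff)
qed

text \<open>Subtracting the decompositions of \<open>x\<close> and \<open>y\<close> into coarse
  pixel and offset cancels the common offset. This turns equal residues into an offset under which
  the network is equivariant.\<close>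

lemma window_offset_eq_imp_scale:
  assumes "window_offset f x = window_offset f y"
  shows "y - x = scale_pixel f (coarse_pixel f y - coarse_pixel f x)"
proof -
  have "y - x = (scale_pixel f (coarse_pixel f y) + window_offset f y) -
      (scale_pixel f (coarse_pixel f x) + window_offset f x)"
    by (simp only: scale_pixel_coarse_pixel_plus_window_offset)
  then show ?thesis by (simp add: assms scale_pixel_diff)
qed

text \<open>\<open>vec_lambda\<close> covers the window by the functions from \<open>'d\<close> to a
  set of \<open>f\<close> integers.\<close>

lemma
  shows finite_window: "finite (window f :: (int ^ 'd::finite) set)"
    and card_window_le: "card (window f :: (int ^ 'd) set) \<le> f ^ CARD('d)"
proof -
  let ?F = "PiE (UNIV :: 'd set) (\<lambda>_. {0..<int f})"
  have sub: "(window f :: (int ^ 'd) set) \<subseteq> vec_lambda ` ?F"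
  proof
    fix i :: "int ^ 'd"
    assume "i \<in> window f"
    then have "vec_nth i \<in> ?F" by (auto simp: window_def)
    then show "i \<in> vec_lambda ` ?F" by (metis image_eqI vec_nth_inverse)
  qed
  have fin: "finite ?F" by (simp add: finite_PiE)
  show "finite (window f :: (int ^ 'd) set)"
    using sub fin by (meson finite_imageI finite_subset)
  have "card (window f :: (int ^ 'd) set) \<le> card ?F"
    using sub fin by (meson card_image_le card_mono finite_imageI le_trans)
  then show "card (window f :: (int ^ 'd) set) \<le> f ^ CARD('d)"
    by (simp add: card_PiE)
qed

lemma shift_commute: "shift u (shift v g) = shift v (shift u g)"
  by (simp add: shift_def algebra_simps)

lemma conv_shift: "conv K A b (shift v g) = shift v (conv K A b g)"
  by (simp add: conv_def shift_def algebra_simps)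

lemma relu_shift: "relu (shift v g) = shift v (relu g)"
  by (simp add: relu_def shift_def)

lemma apply_block_shift: "apply_block ss ws (shift v g) = shift v (apply_block ss ws g)"
  by (induction ss ws g rule: apply_block.induct) (simp_all add: conv_shift relu_shift)

lemma concat_channels_shift:
  "concat_channels (shift v g) (shift v h) = shift v (concat_channels g h)"
  by (simp add: concat_channels_def shift_def)

text \<open>A shift by \<open>f u\<close> carries pooling windows onto pooling windows, since
  \<open>f x + i - f u = f (x - u) + i\<close>.\<close>

lemma maxpool_shift: "maxpool f (shift (scale_pixel f u) g) = shift u (maxpool f g)"
  by (simp add: maxpool_def shift_def scale_pixel_diff algebra_simps)

lemma upsample_shift:
  assumes "pool_factor N \<ge> 1"
  shows "upsample N W i (shift u g) = shift (scale_pixel (pool_factor N) u) (upsample N W i g)"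
  by (cases "upsampling_type N")
    (simp_all add: upsample_def upsample_nearest_def upsample_learnt_def shift_def
      coarse_pixel_diff_scale[OF assms] window_offset_diff_scale)

text \<open>The exponent is \<open>i\<close> and not \<open>Suc i\<close> because only
  \<open>i\<close> poolings precede the output of encoder block \<open>Suc i\<close>.\<close>

lemma enc_out_shift:
  "enc_out N W (shift (scale_pixel (pool_factor N ^ i) u) I) (Suc i) = shift u (enc_out N W I (Suc i))"
proof (induction i arbitrary: u)
  case 0
  then show ?case by (simp add: apply_block_shift)
next
  case (Suc i)
  have "enc_out N W (shift (scale_pixel (pool_factor N ^ Suc i) u) I) (Suc i) =
      shift (scale_pixel (pool_factor N) u) (enc_out N W I (Suc i))"
    \<comment> \<open>Taking \<open>f u\<close> for \<open>u\<close> keeps one factor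
      \<open>f\<close> in reserve for the pooling that follows.\<close>
    using Suc.IH[of "scale_pixel (pool_factor N) u"]
    by (simp only: scale_pixel_mult[symmetric] power_Suc2)
  then show ?case by (simp add: maxpool_shift apply_block_shift del: power_Suc)
qed

text \<open>Block \<open>i\<close> of the decoder works at the resolution reached after
  \<open>i\<close> poolings, where \<open>i\<close> of the \<open>l\<close> factors \<open>f\<close>
  have been divided out. The skip connection and the upsampled image entering it shift by the same
  amount, so their concatenation does too.\<close>

lemma dec_out_shift:
  assumes f: "pool_factor N \<ge> 1" and l: "pool_layers N \<ge> 1" and "i \<le> pool_layers N"
  shows "dec_out N W (shift (scale_pixel (pool_factor N ^ pool_layers N) u) I) i =
    shift (scale_pixel (pool_factor N ^ (pool_layers N - i)) u) (dec_out N W I i)"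
  using assms(3)
proof (induction i rule: inc_induct)
  case base
  \<comment> \<open>The last encoder output has passed \<open>k\<close> poolings and shifts by
    \<open>f u\<close>; the final pooling reduces this to \<open>u\<close>.\<close>
  obtain k where k: "pool_layers N = Suc k" using l by (cases "pool_layers N") auto
  have "scale_pixel (pool_factor N ^ pool_layers N) u =
      scale_pixel (pool_factor N ^ k) (scale_pixel (pool_factor N) u)"
    by (simp only: k power_Suc2 scale_pixel_mult)
  then show ?case
    unfolding dec_out.simps[of N W _ "pool_layers N"]
    using enc_out_shift[of N W k "scale_pixel (pool_factor N) u" I]
    by (simp add: k maxpool_shift apply_block_shift del: power_Suc)
next
  case (step i)
  let ?f = "pool_factor N" and ?l = "pool_layers N"
  let ?v = "scale_pixel (?f ^ ?l) u" and ?w = "scale_pixel (?f ^ (?l - i)) u"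
  \<comment> \<open>The skip connection has used up the factor \<open>?f ^ i\<close>, which leaves
    the shift \<open>?w\<close>.\<close>
  have "?f ^ ?l = ?f ^ i * ?f ^ (?l - i)"
    using step.hyps by (simp flip: power_add)
  then have e: "enc_out N W (shift ?v I) (Suc i) = shift ?w (enc_out N W I (Suc i))"
    by (simp only: scale_pixel_mult enc_out_shift)
  \<comment> \<open>Upsampling multiplies the shift from the induction hypothesis by
    \<open>?f\<close>, which again gives \<open>?w\<close>.\<close>
  have "?f ^ (?l - i) = ?f * ?f ^ (?l - Suc i)"
    using step.hyps by (simp add: Suc_diff_Suc flip: power_Suc)
  then have "upsample N W (Suc i) (dec_out N W (shift ?v I) (Suc i)) =
      shift ?w (upsample N W (Suc i) (dec_out N W I (Suc i)))"
    by (simp only: step.IH upsample_shift[OF f] scale_pixel_mult)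
  with e show ?case
    unfolding dec_out.simps[of N W _ i]
    using step.hyps
    by (simp add: shift_commute[of "alignment N (Suc i)" ?w] concat_channels_shift apply_block_shift)
qed

lemma unet_shift:
  assumes "pool_factor N \<ge> 1" and "pool_layers N \<ge> 1"
  shows "unet N W (shift (scale_pixel (pool_factor N ^ pool_layers N) u) I) =
    shift (scale_pixel (pool_factor N ^ pool_layers N) u) (unet N W I)"
  using dec_out_shift[OF assms, of 0] by (simp add: unet_def)

text \<open>On \<open>S\<close>, \<open>h\<close> factors through \<open>p\<close>:
  \<open>inv_into\<close> picks a representative of each fibre, and \<open>h\<close> is constant on
  fibres.\<close>

lemma
  assumes "finite (p ` S)" and "\<And>x y. x \<in> S \<Longrightarrow> y \<in> S \<Longrightarrow> p x = p y \<Longrightarrow> h x = h y"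
  shows finite_image_factor: "finite (h ` S)"
    and card_image_factor_le: "card (h ` S) \<le> card (p ` S)"
proof -
  have "h x = h (inv_into S p (p x))" if "x \<in> S" for x
    using that assms(2) by (metis f_inv_into_f image_eqI inv_into_into)
  then have "h ` S = (\<lambda>y. h (inv_into S p y)) ` p ` S"
    by (simp add: image_image cong: image_cong)
  then show "finite (h ` S)" "card (h ` S) \<le> card (p ` S)"
    using assms(1) by (simp_all add: card_image_le)
qed

theorem corollary2:
  fixes N :: "'d::finite unet_arch" and W :: "'d unet_weights"
    and l f :: nat
    and I :: "'d image" and S :: "(int ^ 'd) set" and r :: "int ^ 'd"
  assumes "l \<ge> 1" and "f \<ge> 1"
    and "unet_instance N W"
    and "pool_layers N = l" and "pool_factor N = f"
    and "I \<in> images (in_channels N)"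
    and "pairwise (same_looking I) S"
  shows "finite ((\<lambda>c. unet N W I (c + r)) ` S) \<and>
         card ((\<lambda>c. unet N W I (c + r)) ` S) \<le> f ^ (CARD('d) * l)"
proof -
  let ?F = "f ^ l"
  let ?p = "window_offset ?F :: int ^ 'd \<Rightarrow> int ^ 'd"
  have eq: "unet N W I (c + r) = unet N W I (c' + r)"
    if "c \<in> S" "c' \<in> S" and p: "?p c = ?p c'" for c c'
  \<comment> \<open>\<open>pairwise\<close> speaks of distinct elements only.\<close>
  proof (cases "c = c'")
    case False
    then have "shift (c' - c) I = I"
      using that assms(7) by (auto simp: pairwise_def same_looking_def)
    moreover obtain u where "c' - c = scale_pixel ?F u"
      using window_offset_eq_imp_scale[OF p] by blast
    ultimately have "shift (c' - c) (unet N W I) = unet N W I"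
      using unet_shift[of N W u I] assms(1,2,4,5) by simp
    \<comment> \<open>The shifted image at \<open>c' + r\<close> is read at
      \<open>c' + r - (c' - c) = c + r\<close>.\<close>
    then have "unet N W I (c' + r) = shift (c' - c) (unet N W I) (c' + r)" by simp
    then show ?thesis by (simp add: shift_def algebra_simps)
  qed simp
  have sub: "?p ` S \<subseteq> window ?F"
    using assms(2) by (auto intro!: window_offset_in_window)
  then have fin: "finite (?p ` S)" using finite_window finite_subset by blast
  have "card (?p ` S) \<le> ?F ^ CARD('d)"
    using card_mono[OF finite_window sub] card_window_le le_trans by blast
  also have "\<dots> = f ^ (CARD('d) * l)" by (simp add: mult.commute flip: power_mult)
  finally have "card (?p ` S) \<le> f ^ (CARD('d) * l)" .
  with card_image_factor_le[OF fin eq] have "card ((\<lambda>c. unet N W I (c + r)) ` S) \<le> f ^ (CARD('d) * l)"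
    by (rule le_trans)
  with finite_image_factor[OF fin eq] show ?thesis by simp
qed

end
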